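(* Let the schema consist of a unary relation symbol $P$ and a binary relation symbol $R$, and let $\mathbf{T}'$ be the unary CQ $\mathbf{T}'(x)\text{ :- }P(x)\wedge R(y_1,y_2)\wedge R(y_2,y_3)\wedge R(y_3,y_4)\wedge R(y_4,y_5)$. There is no pair $(E^+,E^-)$ of finite sets of acyclic structures with one distinguished element that uniquely characterizes $\mathbf{T}'$ with respect to the class of unary acyclic CQs.
   Context: A unary CQ is $q(x)\text{ :- }\alpha_1\wedge\dots\wedge\alpha_n$ with atoms $\alpha_i$ (other variables existentially quantified), where $x$ occurs in some atom; its canonical structure has its variables as elements, its atoms as facts, and $x$ as the distinguished element. A structure with one distinguished element $(A,a)$ is a positive example for $q$ if $a\in q(A)$ (equivalently, the canonical structure of $q$ maps homomorphically to $(A,a)$ with $x\mapsto a$), negative otherwise. Unary CQs are logically equivalent if they have the same answers on every structure. $(E^+,E^-)$ uniquely characterizes $q$ w.r.t. a class $\mathcal{C}$ if all of $E^+$ are positive and all of $E^-$ negative for $q$, and every $q'\in\mathcal{C}$ with this property is logically equivalent to $q$. The incidence graph of a structure is the bipartite multigraph on its elements and facts with one edge per occurrence of an element in a fact; a structure is acyclic if its incidence graph has no cycle (including length-2 cycles from parallel edges); a CQ is acyclic if its canonical structure is. *)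

theory Defs
  imports Main
begin

text \<open>The schema is fixed: a unary symbol \<open>P\<close> and a binary symbol \<open>R\<close>. The same type serves for the
  atoms of a query (arguments are variables) and the facts of a structure (arguments are elements).\<close>

datatype 'a atom = P_atom 'a | R_atom 'a 'a

fun args :: "'a atom \<Rightarrow> 'a list" where
  "args (P_atom x) = [x]"
| "args (R_atom x y) = [x, y]"

record 'a struct =
  univ :: "'a set"
  facts :: "'a atom set"

text \<open>Structures are finite, as is standard for database instances. The universe may contain elements
  that occur in no fact.\<close>

definition is_structure :: "'a struct \<Rightarrow> bool" where
  "is_structure A \<longleftrightarrow> finite (univ A) \<and> (\<forall>f \<in> facts A. set (args f) \<subseteq> univ A)"

definition is_pointed_structure :: "'a struct \<times> 'a \<Rightarrow> bool" where
  "is_pointed_structure e \<longleftrightarrow> is_structure (fst e) \<and> snd e \<in> univ (fst e)"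

subsection \<open>The incidence multigraph and acyclicity\<close>

definition inc_vertices :: "'a struct \<Rightarrow> ('a + 'a atom) set" where
  "inc_vertices A = univ A <+> facts A"

text \<open>The edge \<open>(f, i)\<close> stands for the occurrence of an element at position \<open>i\<close> of the fact \<open>f\<close>; hence
  \<open>R(a, a)\<close> contributes two parallel edges.\<close>

definition inc_edges :: "'a struct \<Rightarrow> ('a atom \<times> nat) set" where
  "inc_edges A = {(f, i). f \<in> facts A \<and> i < length (args f)}"

definition inc_ends :: "'a atom \<times> nat \<Rightarrow> ('a + 'a atom) set" where
  "inc_ends e = {Inl (args (fst e) ! snd e), Inr (fst e)}"

text \<open>Cycle of the multigraph: pairwise distinct vertices \<open>vs\<close> and pairwise distinct edges \<open>es\<close>, where
  the \<open>i\<close>-th edge joins the \<open>i\<close>-th vertex to its cyclic successor. Length 2 means a pair of parallel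
  edges; length 1 cannot occur because the graph is bipartite.\<close>

definition inc_cycle :: "'a struct \<Rightarrow> ('a + 'a atom) list \<Rightarrow> ('a atom \<times> nat) list \<Rightarrow> bool" where
  "inc_cycle A vs es \<longleftrightarrow>
     vs \<noteq> [] \<and> length es = length vs \<and>
     distinct vs \<and> distinct es \<and>
     set vs \<subseteq> inc_vertices A \<and> set es \<subseteq> inc_edges A \<and>
     (\<forall>i < length vs. inc_ends (es ! i) = {vs ! i, vs ! (Suc i mod length vs)})"

definition acyclic_struct :: "'a struct \<Rightarrow> bool" where
  "acyclic_struct A \<longleftrightarrow> \<not> (\<exists>vs es. inc_cycle A vs es)"

subsection \<open>Unary conjunctive queries\<close>

text \<open>Variables are natural numbers; all variables of the body other than the answer variable are
  existentially quantified.\<close>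

record cq =
  answer_var :: nat
  body :: "nat atom list"

definition vars :: "cq \<Rightarrow> nat set" where
  "vars q = (\<Union>\<alpha> \<in> set (body q). set (args \<alpha>))"

definition is_unary_cq :: "cq \<Rightarrow> bool" where
  "is_unary_cq q \<longleftrightarrow> answer_var q \<in> vars q"

definition canonical_struct :: "cq \<Rightarrow> nat struct" where
  "canonical_struct q = \<lparr>univ = vars q, facts = set (body q)\<rparr>"

definition answers :: "cq \<Rightarrow> 'a struct \<Rightarrow> 'a set" where
  "answers q A =
     {a \<in> univ A. \<exists>h. h ` vars q \<subseteq> univ A \<and> h (answer_var q) = a \<and>
        (\<forall>\<alpha> \<in> set (body q). map_atom h \<alpha> \<in> facts A)}"

definition acyclic_unary_cqs :: "cq set" where
  "acyclic_unary_cqs = {q. is_unary_cq q \<and> acyclic_struct (canonical_struct q)}"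

text \<open>HOL cannot quantify over types inside a formula. Structures being finite, those with elements
  in \<^typ>\<open>nat\<close> cover all of them up to isomorphism.\<close>

definition logically_equivalent :: "cq \<Rightarrow> cq \<Rightarrow> bool" where
  "logically_equivalent q q' \<longleftrightarrow>
     (\<forall>A :: nat struct. is_structure A \<longrightarrow> answers q A = answers q' A)"

definition positive_example :: "cq \<Rightarrow> 'a struct \<times> 'a \<Rightarrow> bool" where
  "positive_example q e \<longleftrightarrow> snd e \<in> answers q (fst e)"

definition negative_example :: "cq \<Rightarrow> 'a struct \<times> 'a \<Rightarrow> bool" where
  "negative_example q e \<longleftrightarrow> \<not> positive_example q e"

definition fits :: "cq \<Rightarrow> ('a struct \<times> 'a) set \<Rightarrow> ('a struct \<times> 'a) set \<Rightarrow> bool" where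
  "fits q Epos Eneg \<longleftrightarrow>
     (\<forall>e \<in> Epos. positive_example q e) \<and> (\<forall>e \<in> Eneg. negative_example q e)"

definition uniquely_characterizes ::
    "('a struct \<times> 'a) set \<Rightarrow> ('a struct \<times> 'a) set \<Rightarrow> cq \<Rightarrow> cq set \<Rightarrow> bool" where
  "uniquely_characterizes Epos Eneg q C \<longleftrightarrow>
     fits q Epos Eneg \<and> (\<forall>q' \<in> C. fits q' Epos Eneg \<longrightarrow> logically_equivalent q' q)"

text \<open>Variable 0 plays the role of \<open>x\<close>, and 1 to 5 those of \<open>y\<^sub>1\<close> to \<open>y\<^sub>5\<close>.\<close>

definition T' :: cq where
  "T' = \<lparr>answer_var = 0,
         body = [P_atom 0, R_atom 1 2, R_atom 2 3, R_atom 3 4, R_atom 4 5]\<rparr>"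

end

theory Submission
  imports Defs
begin

text \<open>The queries below map homomorphically to \<open>T'\<close>, hence fit all positive examples, but do not
  admit \<open>T'\<close> because their \<open>R\<close>-walks have length at most 3. Their binary part is a tree with the
  spine \<open>a\<^sub>0 \<rightarrow> b\<^sub>0 \<rightarrow> c\<^sub>0 \<leftarrow> d\<^sub>0 \<leftarrow> a\<^sub>1 \<rightarrow> b\<^sub>1 \<rightarrow> c\<^sub>1 \<leftarrow> \<dots>\<close> and pendant paths \<open>b\<^sub>i \<rightarrow> e\<^sub>i \<rightarrow> f\<^sub>i\<close> and
  \<open>g\<^sub>i \<rightarrow> h\<^sub>i \<rightarrow> d\<^sub>i\<close>. A homomorphism into a structure without \<open>R\<close>-walks of length 4 cannot
  identify two spine vertices at distance 2: identifying a \<open>b\<close> with a \<open>d\<close> would give the walk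
  \<open>g \<rightarrow> h \<rightarrow> d = b \<rightarrow> e \<rightarrow> f\<close>. So it maps the spine to a walk without backtracking, which in an
  acyclic structure is a simple path; this is impossible once the spine is longer than the
  structure is large.\<close>

section \<open>Acyclicity of the incidence graph\<close>

text \<open>A vertex of maximal rank on a cycle would have two edges that do not increase the rank.\<close>

lemma acyclic_struct_rankI:
  fixes rank :: "'a + 'a atom \<Rightarrow> nat"
  assumes unique: "\<And>v u u' e e'. \<lbrakk>e \<in> inc_edges A; e' \<in> inc_edges A; inc_ends e = {v, u};
      inc_ends e' = {v, u'}; rank u \<le> rank v; rank u' \<le> rank v\<rbrakk> \<Longrightarrow> e = e'"
  shows "acyclic_struct A"
  unfolding acyclic_struct_def
proof (intro notI, elim exE)
  fix vs es assume cyc: "inc_cycle A vs es"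
  let ?L = "length vs"
  have L0: "?L > 0" and len: "length es = ?L" and dist: "distinct es"
    and es: "set es \<subseteq> inc_edges A"
    and ends: "\<And>i. i < ?L \<Longrightarrow> inc_ends (es ! i) = {vs ! i, vs ! (Suc i mod ?L)}"
    using cyc by (auto simp: inc_cycle_def)
  \<comment> \<open>With a single vertex both ends of the edge would coincide, but one end is an
    element and the other a fact.\<close>
  have "?L \<noteq> 1"
    using ends[of 0] L0 by (auto simp: inc_ends_def doubleton_eq_iff) (metis sum.distinct(1))+
  with L0 have L2: "?L \<ge> 2" by linarith
  obtain i where i: "i < ?L" and max: "\<And>j. j < ?L \<Longrightarrow> rank (vs ! j) \<le> rank (vs ! i)"
  proof -
    let ?S = "(\<lambda>j. rank (vs ! j)) ` {..<?L}"
    have "Max ?S \<in> ?S" using L0 by (intro Max_in) auto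
    then obtain i where "i < ?L" "rank (vs ! i) = Max ?S" by auto
    then show thesis by (intro that[of i]) auto
  qed
  \<comment> \<open>\<open>p\<close> is the cyclic predecessor of \<open>i\<close>, so
    \<open>es ! p\<close> and \<open>es ! i\<close> are the two cycle edges at the vertex of maximal
    rank.\<close>
  define p where "p = (if i = 0 then ?L - 1 else i - 1)"
  have p: "p < ?L" "Suc p mod ?L = i" "p \<noteq> i" using i L2 by (auto simp: p_def)
  have "es ! i = es ! p"
  proof (rule unique)
    show "es ! i \<in> inc_edges A" "es ! p \<in> inc_edges A" using es i p len by auto
    show "inc_ends (es ! i) = {vs ! i, vs ! (Suc i mod ?L)}" using ends i by simp
    show "inc_ends (es ! p) = {vs ! i, vs ! p}" using ends[of p] p by auto
    show "rank (vs ! (Suc i mod ?L)) \<le> rank (vs ! i)" using L0 by (intro max) simp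
    show "rank (vs ! p) \<le> rank (vs ! i)" using p by (intro max) simp
  qed
  with dist i p len show False by (simp add: nth_eq_iff_index_eq)
qed

text \<open>The binary facts form a forest: the only fact in which a number is the larger argument
  acts as the edge to its parent.\<close>

lemma acyclic_struct_natI:
  fixes A :: "nat struct"
  assumes irrefl: "\<And>x y. R_atom x y \<in> facts A \<Longrightarrow> x \<noteq> y"
    and unique: "\<And>x y x' y'. \<lbrakk>R_atom x y \<in> facts A; R_atom x' y' \<in> facts A;
      max x y = max x' y'\<rbrakk> \<Longrightarrow> x = x' \<and> y = y'"
  shows "acyclic_struct A"
proof (rule acyclic_struct_rankI)
  \<comment> \<open>An \<open>R\<close>-fact lies just below its larger argument and above its
    smaller one; a \<open>P\<close>-fact lies just above its element. Hence from any vertex at most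
    one edge does not go up.\<close>
  define rank :: "nat + nat atom \<Rightarrow> nat" where
    "rank = case_sum (\<lambda>x. 2 * x + 1)
       (\<lambda>f. case f of P_atom x \<Rightarrow> 2 * x + 2 | R_atom x y \<Rightarrow> 2 * max x y)"
  fix v u u' e e'
  assume e: "e \<in> inc_edges A" and e': "e' \<in> inc_edges A"
    and ends: "inc_ends e = {v, u}" "inc_ends e' = {v, u'}"
    and le: "rank u \<le> rank v" "rank u' \<le> rank v"
  obtain f i where ei: "e = (f, i)" "f \<in> facts A" "i < length (args f)"
    using e by (auto simp: inc_edges_def)
  obtain g j where ej: "e' = (g, j)" "g \<in> facts A" "j < length (args g)"
    using e' by (auto simp: inc_edges_def)
  show "e = e'"
  proof (cases v)
    case (Inl x)
    with ends ei ej have u: "u = Inr f" "args f ! i = x" "u' = Inr g" "args g ! j = x"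
      by (auto simp: inc_ends_def doubleton_eq_iff)
    have R: "\<exists>p q. k = R_atom p q \<and> max p q = x"
      if "args k ! l = x" "l < length (args k)" "rank (Inr k) \<le> rank (Inl x)" for k l
      using that by (cases k) (auto simp: rank_def less_Suc_eq)
    obtain p q where f: "f = R_atom p q" "max p q = x"
      using R[of f i] u ei le Inl by auto
    obtain p' q' where g: "g = R_atom p' q'" "max p' q' = x"
      using R[of g j] u ej le Inl by auto
    have "f = g" using unique[of p q p' q'] f g ei(2) ej(2) by simp
    moreover have "i = j"
      using u(2,4) \<open>f = g\<close> f(1) ei(2,3) ej(3) irrefl[of p q] by (auto simp: less_Suc_eq)
    ultimately show ?thesis using ei ej by simp
  next
    case (Inr k)
    with ends ei ej have u: "f = k" "u = Inl (args k ! i)" "g = k" "u' = Inl (args k ! j)"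
      by (auto simp: inc_ends_def doubleton_eq_iff)
    have "i = j"
    proof (cases k)
      case (P_atom x)
      then show ?thesis using u ei(3) ej(3) by simp
    next
      case (R_atom x y)
      then have "args k ! i \<noteq> max x y" "args k ! j \<noteq> max x y"
        using le u Inr by (auto simp: rank_def)
      then show ?thesis using R_atom u ei(3) ej(3) by (auto simp: less_Suc_eq max_def split: if_splits)
    qed
    then show ?thesis using ei(1) ej(1) u by simp
  qed
qed

section \<open>Closed and non-backtracking walks\<close>

definition adjacent :: "'a struct \<Rightarrow> 'a \<Rightarrow> 'a \<Rightarrow> bool" where
  "adjacent A x y \<longleftrightarrow> R_atom x y \<in> facts A \<or> R_atom y x \<in> facts A"

text \<open>Interleaving the elements of the walk with the facts joining them gives an incidence
  cycle of length \<open>2 * m\<close>. The bound \<open>m \<ge> 3\<close> keeps these facts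
  distinct: a walk of length 2 may use one fact in both directions.\<close>

lemma closed_walk_not_acyclic:
  fixes w :: "nat \<Rightarrow> 'a"
  assumes A: "is_structure A" and m: "m \<ge> 3"
    and adj: "\<And>k. k < m \<Longrightarrow> adjacent A (w k) (w (Suc k))"
    and inj: "inj_on w {..<m}" and closed: "w m = w 0"
  shows "\<not> acyclic_struct A"
proof -
  define fwd where "fwd k \<longleftrightarrow> R_atom (w k) (w (Suc k)) \<in> facts A" for k
  define F where "F k = (if fwd k then R_atom (w k) (w (Suc k)) else R_atom (w (Suc k)) (w k))" for k
  \<comment> \<open>Even positions carry elements, odd positions facts. \<open>E i\<close> picks the
    argument position of the element among \<open>V i\<close> and \<open>V (Suc i)\<close>, which
    depends on the direction of the fact.\<close>
  define V where "V i = (if even i then Inl (w (i div 2)) else Inr (F (i div 2)))" for i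
  define E where "E i = (F (i div 2), if even i = fwd (i div 2) then 0 else 1 :: nat)" for i
  have F: "F k \<in> facts A" if "k < m" for k
    using adj[OF that] by (auto simp: F_def fwd_def adjacent_def)
  have args_F: "args (F k) = (if fwd k then [w k, w (Suc k)] else [w (Suc k), w k])" for k
    by (simp add: F_def)
  have w_eq: "w i = w j \<longleftrightarrow> i = j \<or> i = 0 \<and> j = m \<or> i = m \<and> j = 0" if "i \<le> m" "j \<le> m" for i j
  proof (cases "i = m \<or> j = m")
    case True
    have "w k = w 0 \<longleftrightarrow> k = 0 \<or> k = m" if "k \<le> m" for k
      using inj_onD[OF inj, of 0 k] that closed m by (cases "k = m") auto
    from this[of i] this[of j] show ?thesis using True that closed m by auto
  next
    case False
    then show ?thesis using inj_on_eq_iff[OF inj, of i j] that by auto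
  qed
  have F_inj: "k = l" if "F k = F l" "k < m" "l < m" for k l
  proof -
    have "set (args (F k)) = set (args (F l))" using that by simp
    then have "{w k, w (Suc k)} = {w l, w (Suc l)}" by (auto simp: F_def split: if_splits)
    then have "w k = w l \<or> w k = w (Suc l) \<and> w (Suc k) = w l"
      by (auto simp: doubleton_eq_iff)
    moreover have "w k = w l \<longleftrightarrow> k = l" using that w_eq[of k l] by auto
    moreover have "w k = w (Suc l) \<longleftrightarrow> k = Suc l \<or> k = 0 \<and> Suc l = m"
      using that w_eq[of k "Suc l"] by auto
    moreover have "w (Suc k) = w l \<longleftrightarrow> l = Suc k \<or> l = 0 \<and> Suc k = m"
      using that w_eq[of "Suc k" l] by auto
    \<comment> \<open>If steps \<open>k\<close> and \<open>l\<close> had the same two ends in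
      opposite order, the walk would close after at most two steps.\<close>
    ultimately show ?thesis using m by linarith
  qed
  have half: "i div 2 < m" if "i < 2 * m" for i using that by linarith
  have half_eq: "i = j" if "i div 2 = j div 2" "even i = even j" for i j :: nat
    using that by presburger
  have "inc_cycle A (map V [0..<2 * m]) (map E [0..<2 * m])"
    unfolding inc_cycle_def
  proof (intro conjI allI impI)
    show "map V [0..<2 * m] \<noteq> []" using m by simp
    show "length (map E [0..<2 * m]) = length (map V [0..<2 * m])" by simp
    have "inj_on V {0..<2 * m}"
    proof (intro inj_onI)
      fix i j assume ij: "i \<in> {0..<2 * m}" "j \<in> {0..<2 * m}" and eq: "V i = V j"
      have lt: "i div 2 < m" "j div 2 < m" using ij half by simp_all
      from eq have par: "even i = even j" by (simp add: V_def split: if_splits)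
      have "i div 2 = j div 2"
      proof (cases "even i")
        case True
        with eq par have "w (i div 2) = w (j div 2)" by (simp add: V_def)
        with lt inj show ?thesis by (simp add: inj_on_eq_iff)
      next
        case False
        with eq par have "F (i div 2) = F (j div 2)" by (simp add: V_def)
        with lt show ?thesis by (simp add: F_inj)
      qed
      from this par show "i = j" by (rule half_eq)
    qed
    then show "distinct (map V [0..<2 * m])" by (simp add: distinct_map)
    have "inj_on E {0..<2 * m}"
    proof (intro inj_onI)
      fix i j assume ij: "i \<in> {0..<2 * m}" "j \<in> {0..<2 * m}" and eq: "E i = E j"
      have lt: "i div 2 < m" "j div 2 < m" using ij half by simp_all
      from eq have "F (i div 2) = F (j div 2)" by (simp add: E_def)
      with lt have div: "i div 2 = j div 2" by (simp add: F_inj)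
      with eq have "even i = even j" by (simp add: E_def split: if_splits)
      with div show "i = j" by (rule half_eq)
    qed
    then show "distinct (map E [0..<2 * m])" by (simp add: distinct_map)
    have "w k \<in> univ A" if "k < m" for k
    proof -
      have "set (args (F k)) \<subseteq> univ A" using A F[OF that] by (simp add: is_structure_def)
      then show ?thesis by (simp add: args_F split: if_splits)
    qed
    then show "set (map V [0..<2 * m]) \<subseteq> inc_vertices A"
      by (auto simp: V_def inc_vertices_def half F)
    have "E i \<in> inc_edges A" if "i < 2 * m" for i
      using F[OF half[OF that]] by (simp add: E_def inc_edges_def args_F)
    then show "set (map E [0..<2 * m]) \<subseteq> inc_edges A" by auto
  next
    fix i assume "i < length (map V [0..<2 * m])"
    then have i: "i < 2 * m" by simp
    have "V (Suc i mod (2 * m)) = V (Suc i)"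
    proof (cases "Suc i = 2 * m")
      case True then show ?thesis by (simp add: V_def closed)
    next
      case False with i show ?thesis by simp
    qed
    moreover have "inc_ends (E i) = {V i, V (Suc i)}"
      by (cases "even i") (simp_all add: inc_ends_def E_def V_def args_F insert_commute)
    ultimately show "inc_ends (map E [0..<2 * m] ! i) = {map V [0..<2 * m] ! i,
        map V [0..<2 * m] ! (Suc i mod length (map V [0..<2 * m]))}"
      using i by simp
  qed
  then show ?thesis by (auto simp: acyclic_struct_def)
qed

text \<open>By induction on the distance \<open>m\<close> of two positions: a first return after 1
  step needs a loop, after 2 steps a backtrack, and after 3 or more it is a simple closed
  walk.\<close>

lemma nonbacktracking_walk_inj:
  fixes w :: "nat \<Rightarrow> 'a"
  assumes A: "is_structure A" "acyclic_struct A"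
    and adj: "\<And>k. k < n \<Longrightarrow> adjacent A (w k) (w (Suc k))"
    and irrefl: "\<And>x. R_atom x x \<notin> facts A"
    and nb: "\<And>k. Suc k < n \<Longrightarrow> w k \<noteq> w (Suc (Suc k))"
  shows "inj_on w {..n}"
proof -
  have "w k \<noteq> w (k + m)" if "0 < m" "k + m \<le> n" for k m
    using that
  proof (induction m arbitrary: k rule: less_induct)
    case (less m)
    show ?case
    proof
      assume eq: "w k = w (k + m)"
      have "w k \<noteq> w (Suc k)" using adj[of k] irrefl less.prems by (auto simp: adjacent_def)
      moreover have "w k \<noteq> w (Suc (Suc k))" if "m = 2" using nb[of k] less.prems that by simp
      ultimately have "m \<noteq> 1" "m \<noteq> 2" using eq by auto
      with less.prems have "m \<ge> 3" by linarith
      moreover have "inj_on (\<lambda>i. w (k + i)) {..<m}"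
      proof (rule linorder_inj_onI)
        fix i j assume "i < j" "i \<in> {..<m}" "j \<in> {..<m}"
        then show "w (k + i) \<noteq> w (k + j)"
          using less.IH[of "j - i" "k + i"] less.prems by simp
      qed auto
      ultimately have "\<not> acyclic_struct A"
        using closed_walk_not_acyclic[OF A(1), of m "\<lambda>i. w (k + i)"] adj less.prems eq by simp
      with A show False by simp
    qed
  qed
  then have "w i \<noteq> w j" if "i < j" "j \<le> n" for i j
    using that by (metis le_add_diff_inverse less_imp_le_nat zero_less_diff)
  then show ?thesis by (intro linorder_inj_onI) auto
qed

section \<open>The competing queries\<close>

text \<open>In block \<open>i\<close> the variables \<open>a, b, c, d, e, f, h, g\<close> are \<open>8 * i + 1, \<dots>, 8 * i + 8\<close>. The atom
  \<open>tree_atom k\<close> joins \<open>k\<close> to its parent, a smaller variable; \<open>a\<^sub>0\<close>, which is 1, is the root.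
  The list is indexed by \<open>k mod 8\<close>, so it starts with \<open>g\<close>.\<close>

definition tree_atom :: "nat \<Rightarrow> nat atom" where
  "tree_atom k =
     [R_atom k (k - 1), R_atom k (k - 5), R_atom (k - 1) k, R_atom (k - 1) k,
      R_atom k (k - 1), R_atom (k - 3) k, R_atom (k - 1) k, R_atom k (k - 3)] ! (k mod 8)"

text \<open>The answer variable 0 lies outside the tree. For \<open>n > 0\<close> the bound
  \<open>8 * n\<close> cuts the last block before its \<open>g\<close>.\<close>

definition zigzag_cq :: "nat \<Rightarrow> cq" where
  "zigzag_cq n = \<lparr>answer_var = 0, body = P_atom 0 # map tree_atom [2..<8 * n]\<rparr>"

text \<open>The offsets run to 9 because the edge from \<open>a\<close> of the next block to its
  parent \<open>d\<close> is counted with the block of \<open>d\<close>.\<close>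

lemma block_cases:
  fixes k :: nat
  assumes "k \<ge> 2"
  obtains i r where "k = 8 * i + r" "r \<in> {2, 3, 4, 5, 6, 7, 8, 9}"
proof (rule that)
  show "k = 8 * ((k - 2) div 8) + ((k - 2) mod 8 + 2)" using assms by presburger
  have "(k - 2) mod 8 + 2 \<in> {2..<10}" by simp
  also have "{2..<10} = {2, 3, 4, 5, 6, 7, 8, 9 :: nat}"
    by (auto simp: eval_nat_numeral less_Suc_eq)
  finally show "(k - 2) mod 8 + 2 \<in> {2, 3, 4, 5, 6, 7, 8, 9}" .
qed

lemma Suc_Suc_mod_8 [simp]: "Suc (Suc (8 * i)) mod 8 = 2"
  by presburger

lemma tree_atom_block:
  "tree_atom (8 * i + 2) = R_atom (8 * i + 1) (8 * i + 2)"
  "tree_atom (8 * i + 3) = R_atom (8 * i + 2) (8 * i + 3)"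
  "tree_atom (8 * i + 4) = R_atom (8 * i + 4) (8 * i + 3)"
  "tree_atom (8 * i + 5) = R_atom (8 * i + 2) (8 * i + 5)"
  "tree_atom (8 * i + 6) = R_atom (8 * i + 5) (8 * i + 6)"
  "tree_atom (8 * i + 7) = R_atom (8 * i + 7) (8 * i + 4)"
  "tree_atom (8 * i + 8) = R_atom (8 * i + 8) (8 * i + 7)"
  "tree_atom (8 * i + 9) = R_atom (8 * Suc i + 1) (8 * i + 4)"
  by (simp_all add: tree_atom_def)

lemma tree_atom_parent:
  assumes "k \<ge> 2"
  shows "\<exists>p < k. tree_atom k = R_atom p k \<or> tree_atom k = R_atom k p"
  using assms by (rule block_cases) (auto simp: tree_atom_def)

text \<open>Every variable other than the root is the larger one in exactly one possible tree atom,
  the one to its parent.\<close>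

lemma acyclic_zigzag: "zigzag_cq n \<in> acyclic_unary_cqs"
proof -
  have atom_max: "R_atom x y = tree_atom (max x y) \<and> x \<noteq> y"
    if "R_atom x y \<in> facts (canonical_struct (zigzag_cq n))" for x y
  proof -
    from that obtain k where k: "k \<ge> 2" "R_atom x y = tree_atom k"
      by (auto simp: canonical_struct_def zigzag_cq_def)
    obtain p where "p < k" "tree_atom k = R_atom p k \<or> tree_atom k = R_atom k p"
      using tree_atom_parent[OF k(1)] by blast
    with k(2) have "max x y = k" "x \<noteq> y" by auto
    with k(2) show ?thesis by simp
  qed
  have "acyclic_struct (canonical_struct (zigzag_cq n))"
  proof (rule acyclic_struct_natI)
    fix x y x' y'
    assume "R_atom x y \<in> facts (canonical_struct (zigzag_cq n))"
      "R_atom x' y' \<in> facts (canonical_struct (zigzag_cq n))" "max x y = max x' y'"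
    then have "R_atom x y = R_atom x' y'" by (metis atom_max)
    then show "x = x' \<and> y = y'" by simp
  qed (metis atom_max)
  moreover have "is_unary_cq (zigzag_cq n)"
    by (simp add: is_unary_cq_def zigzag_cq_def vars_def)
  ultimately show ?thesis by (simp add: acyclic_unary_cqs_def)
qed

section \<open>Comparison of the answers with those of \<open>T'\<close>\<close>

lemma answers_hom:
  assumes body: "\<And>\<alpha>. \<alpha> \<in> set (body q) \<Longrightarrow> map_atom g \<alpha> \<in> set (body q')"
    and ans: "g (answer_var q) = answer_var q'"
  shows "answers q' A \<subseteq> answers q A"
proof
  fix a assume "a \<in> answers q' A"
  then obtain h where h: "a \<in> univ A" "h ` vars q' \<subseteq> univ A" "h (answer_var q') = a"
    "\<And>\<alpha>. \<alpha> \<in> set (body q') \<Longrightarrow> map_atom h \<alpha> \<in> facts A"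
    by (auto simp: answers_def)
  have "set (args (map_atom g \<alpha>)) = g ` set (args \<alpha>)" for \<alpha> :: "nat atom"
    by (cases \<alpha>) auto
  then have "g ` vars q \<subseteq> vars q'" using body by (fastforce simp: vars_def)
  then have "(h \<circ> g) ` vars q \<subseteq> univ A" using h(2) by (auto simp: image_comp[symmetric])
  moreover have "map_atom (h \<circ> g) \<alpha> \<in> facts A" if "\<alpha> \<in> set (body q)" for \<alpha>
    using h(4)[OF body[OF that]] by (simp add: atom.map_comp)
  ultimately show "a \<in> answers q A"
    using h ans by (auto simp: answers_def intro!: exI[of _ "h \<circ> g"])
qed

lemma answers_T':
  assumes "is_structure A"
  shows "a \<in> answers T' A \<longleftrightarrow> P_atom a \<in> facts A \<and>
    (\<exists>u v w x y. {R_atom u v, R_atom v w, R_atom w x, R_atom x y} \<subseteq> facts A)"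
proof
  assume "a \<in> answers T' A"
  then obtain h where h: "h (answer_var T') = a"
    "\<And>\<alpha>. \<alpha> \<in> set (body T') \<Longrightarrow> map_atom h \<alpha> \<in> facts A"
    unfolding answers_def by blast
  have "{P_atom a, R_atom (h 1) (h 2), R_atom (h 2) (h 3), R_atom (h 3) (h 4),
      R_atom (h 4) (h 5)} \<subseteq> facts A"
    using h(1) h(2)[of "P_atom 0"] h(2)[of "R_atom 1 2"] h(2)[of "R_atom 2 3"]
      h(2)[of "R_atom 3 4"] h(2)[of "R_atom 4 5"]
    by (simp add: T'_def)
  then show "P_atom a \<in> facts A \<and>
    (\<exists>u v w x y. {R_atom u v, R_atom v w, R_atom w x, R_atom x y} \<subseteq> facts A)"
    by (metis insert_subset)
next
  assume "P_atom a \<in> facts A \<and>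
    (\<exists>u v w x y. {R_atom u v, R_atom v w, R_atom w x, R_atom x y} \<subseteq> facts A)"
  then obtain u v w x y where
    f: "{P_atom a, R_atom u v, R_atom v w, R_atom w x, R_atom x y} \<subseteq> facts A" by auto
  with assms have "{a, u, v, w, x, y} \<subseteq> univ A" by (fastforce simp: is_structure_def)
  with f show "a \<in> answers T' A"
    by (auto simp: answers_def T'_def vars_def nth_Cons'
        intro!: exI[of _ "\<lambda>i. [a, u, v, w, x, y] ! i"])
qed

lemma answers_T'_subset_zigzag: "answers T' A \<subseteq> answers (zigzag_cq n) A"
proof (rule answers_hom)
  \<comment> \<open>Each tree atom raises the level by one: \<open>g\<close> has level 1,
    \<open>a\<close> and \<open>h\<close> 2, \<open>b\<close> and \<open>d\<close> 3,
    \<open>c\<close> and \<open>e\<close> 4, \<open>f\<close> 5. Variable 0 is split off since it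
    shares its residue with \<open>g\<close>.\<close>
  define level :: "nat \<Rightarrow> nat" where
    "level x = (if x = 0 then 0 else [1, 2, 3, 4, 3, 4, 5, 2] ! (x mod 8))" for x
  have "map_atom level (tree_atom k) \<in> set (body T')" if "k \<ge> 2" for k
    using that by (rule block_cases) (auto simp: tree_atom_def level_def T'_def)
  then show "map_atom level \<alpha> \<in> set (body T')" if "\<alpha> \<in> set (body (zigzag_cq n))" for \<alpha>
    using that by (auto simp: zigzag_cq_def) (auto simp: T'_def level_def)
  show "level (answer_var (zigzag_cq n)) = answer_var T'"
    by (simp add: level_def zigzag_cq_def T'_def)
qed

text \<open>The transitive tournament on four vertices separates the two queries.\<close>

lemma zigzag_not_equivalent: "\<not> logically_equivalent (zigzag_cq n) T'"
proof
  assume eq: "logically_equivalent (zigzag_cq n) T'"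
  define A :: "nat struct" where
    "A = \<lparr>univ = {..3}, facts = insert (P_atom 0) {R_atom x y | x y. x < y \<and> y \<le> 3}\<rparr>"
  have A: "is_structure A" by (auto simp: is_structure_def A_def)
  \<comment> \<open>Each tree atom strictly increases \<open>h\<close>. Four values suffice because
    \<open>b\<close> goes to 1 and \<open>d\<close> to 2, whereas \<open>T'\<close> needs a chain of
    five.\<close>
  define h :: "nat \<Rightarrow> nat" where
    "h x = (if x = 0 then 0 else [0, 0, 1, 3, 2, 2, 3, 1] ! (x mod 8))" for x
  have h: "h x \<le> 3" for x
  proof -
    have "\<forall>i < 8. [0, 0, 1, 3, 2, 2, 3, 1] ! i \<le> (3 :: nat)"
      by (simp add: eval_nat_numeral All_less_Suc)
    then show ?thesis by (simp add: h_def)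
  qed
  have "map_atom h (tree_atom k) \<in> facts A" if "k \<ge> 2" for k
    using that by (rule block_cases) (auto simp: tree_atom_def h_def A_def)
  moreover have "P_atom (h 0) \<in> facts A" by (simp add: h_def A_def)
  ultimately have "\<forall>\<alpha> \<in> set (body (zigzag_cq n)). map_atom h \<alpha> \<in> facts A"
    by (auto simp: zigzag_cq_def)
  moreover have "h (answer_var (zigzag_cq n)) = 0" by (simp add: zigzag_cq_def h_def)
  moreover have "h ` X \<subseteq> univ A" for X using h by (auto simp: A_def)
  moreover have "0 \<in> univ A" by (simp add: A_def)
  ultimately have "0 \<in> answers (zigzag_cq n) A" unfolding answers_def by blast
  moreover have "0 \<notin> answers T' A"
    by (auto simp: answers_T'[OF A]) (auto simp: A_def)
  ultimately show False using eq A by (auto simp: logically_equivalent_def)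
qed

section \<open>Zigzag queries on small acyclic structures\<close>

text \<open>On acyclic structures with fewer than \<open>n\<close> elements every answer of the
  zigzag query is one of \<open>T'\<close>, so small negative examples stay negative.\<close>

lemma zigzag_answers_large:
  assumes A: "is_structure A" "acyclic_struct A"
    and a: "a \<in> answers (zigzag_cq n) A" and neg: "a \<notin> answers T' A"
  shows "n \<le> card (univ A)"
proof (rule ccontr)
  assume small: "\<not> n \<le> card (univ A)"
  obtain h where h: "h (answer_var (zigzag_cq n)) = a"
    "\<And>\<alpha>. \<alpha> \<in> set (body (zigzag_cq n)) \<Longrightarrow> map_atom h \<alpha> \<in> facts A"
    using a unfolding answers_def by blast
  have Pa: "P_atom a \<in> facts A"
    using h(1) h(2)[of "P_atom 0"] by (simp add: zigzag_cq_def)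
  have hom: "map_atom h (tree_atom k) \<in> facts A" if "2 \<le> k" "k < 8 * n" for k
    using h(2)[of "tree_atom k"] that by (simp add: zigzag_cq_def)
  \<comment> \<open>Since \<open>P\<close> holds at \<open>a\<close>, only the missing walk can keep
    \<open>a\<close> from being an answer of \<open>T'\<close>.\<close>
  have no_walk: False if "R_atom u v \<in> facts A" "R_atom v w \<in> facts A" "R_atom w x \<in> facts A"
    "R_atom x y \<in> facts A" for u v w x y
    using neg that Pa answers_T'[OF A(1)] by blast
  have irrefl: "R_atom x x \<notin> facts A" for x using no_walk by blast
  define r where "r i j = h (8 * i + j)" for i j
  have R: "R_atom (r i 1) (r i 2) \<in> facts A" "R_atom (r i 2) (r i 3) \<in> facts A"
    "R_atom (r i 4) (r i 3) \<in> facts A" "R_atom (r i 2) (r i 5) \<in> facts A"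
    "R_atom (r i 5) (r i 6) \<in> facts A" "R_atom (r i 7) (r i 4) \<in> facts A" if "i < n" for i
    using that hom[of "8 * i + 2"] hom[of "8 * i + 3"] hom[of "8 * i + 4"]
      hom[of "8 * i + 5"] hom[of "8 * i + 6"] hom[of "8 * i + 7"]
    unfolding tree_atom_block r_def by simp_all
  \<comment> \<open>These atoms have indices \<open>8 * i + 8\<close> and \<open>8 * i + 9\<close>,
    which are below \<open>8 * n\<close> only if another block follows.\<close>
  have R': "R_atom (r i 8) (r i 7) \<in> facts A" "R_atom (r (Suc i) 1) (r i 4) \<in> facts A"
    if "Suc i < n" for i
    using that hom[of "8 * i + 8"] hom[of "8 * i + 9"]
    unfolding tree_atom_block r_def by simp_all
  \<comment> \<open>\<open>w\<close> runs through the images of the spine, four per block: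
    \<open>a\<close>, \<open>b\<close>, \<open>c\<close>, \<open>d\<close>.\<close>
  define w where "w j = r (j div 4) (j mod 4 + 1)" for j
  have w_block: "w (4 * i + t) = r i (t + 1)" if "t < 4" for i t
    using that by (simp add: w_def)
  have w: "w (4 * i) = r i 1" "w (Suc (4 * i)) = r i 2" "w (Suc (Suc (4 * i))) = r i 3"
    "w (Suc (Suc (Suc (4 * i)))) = r i 4" "w (Suc (Suc (Suc (Suc (4 * i))))) = r (Suc i) 1"
    "w (Suc (Suc (Suc (Suc (Suc (4 * i)))))) = r (Suc i) 2" for i
    using w_block[of 0 i] w_block[of 1 i] w_block[of 2 i] w_block[of 3 i]
      w_block[of 0 "Suc i"] w_block[of 1 "Suc i"]
    by (simp_all add: eval_nat_numeral add_ac)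
  have four: thesis
    if "\<And>i. j \<in> {4 * i, Suc (4 * i), Suc (Suc (4 * i)), Suc (Suc (Suc (4 * i)))} \<Longrightarrow> thesis"
    for j :: nat and thesis
  proof (rule that[of "j div 4"])
    have "j = 4 * (j div 4) \<or> j = Suc (4 * (j div 4)) \<or> j = Suc (Suc (4 * (j div 4)))
      \<or> j = Suc (Suc (Suc (4 * (j div 4))))" by presburger
    then show "j \<in> {4 * (j div 4), Suc (4 * (j div 4)), Suc (Suc (4 * (j div 4))),
      Suc (Suc (Suc (4 * (j div 4))))}" by simp
  qed
  \<comment> \<open>The first \<open>n\<close> spine vertices are enough. As
    \<open>i \<le> 4 * i \<le> k\<close>, both block \<open>i\<close> and its successor are
    present.\<close>
  have adj: "adjacent A (w k) (w (Suc k))" if "k < n - 1" for k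
  proof (rule four[of k])
    fix i assume k: "k \<in> {4 * i, Suc (4 * i), Suc (Suc (4 * i)), Suc (Suc (Suc (4 * i)))}"
    then have "i < n" "Suc i < n" using that by auto
    with R[of i] R'[of i] k w[of i] show ?thesis by (auto simp: adjacent_def)
  qed
  have nb: "w k \<noteq> w (Suc (Suc k))" if "Suc k < n - 1" for k
  proof (rule four[of k])
    fix i assume k: "k \<in> {4 * i, Suc (4 * i), Suc (Suc (4 * i)), Suc (Suc (Suc (4 * i)))}"
    then have i: "i < n" "Suc i < n" using that by auto
    note facts = R[OF i(1)] R[OF i(2)] R'[OF i(2)]
    \<comment> \<open>Identifying an \<open>a\<close> with the \<open>c\<close> two steps away
      closes a walk of length 2, which traversed twice has length 4; identifying a \<open>b\<close>
      with a \<open>d\<close> joins their pendant paths.\<close>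
    have "r i 1 \<noteq> r i 3" "r i 3 \<noteq> r (Suc i) 1" "r i 2 \<noteq> r i 4" "r i 4 \<noteq> r (Suc i) 2"
      using facts no_walk by metis+
    with k w[of i] show ?thesis by auto
  qed
  have "inj_on w {..n - 1}"
    using A adj irrefl nb by (rule nonbacktracking_walk_inj)
  moreover have "w ` {..n - 1} \<subseteq> univ A"
  proof (clarify, rule four)
    fix j i
    assume j: "j \<le> n - 1" "j \<in> {4 * i, Suc (4 * i), Suc (Suc (4 * i)), Suc (Suc (Suc (4 * i)))}"
    then have "i < n" using small by auto
    from R[OF this] A(1) have "{r i 1, r i 2, r i 3, r i 4} \<subseteq> univ A"
      by (fastforce simp: is_structure_def)
    with j w[of i] show "w j \<in> univ A" by auto
  qed
  moreover have "finite (univ A)" using A(1) by (simp add: is_structure_def)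
  ultimately have "card {..n - 1} \<le> card (univ A)" by (rule card_inj_on_le)
  with small show False by simp
qed

theorem theorem4p8:
  "\<not> (\<exists>Epos Eneg :: ('a struct \<times> 'a) set.
        finite Epos \<and> finite Eneg \<and>
        (\<forall>e \<in> Epos \<union> Eneg. is_pointed_structure e \<and> acyclic_struct (fst e)) \<and>
        uniquely_characterizes Epos Eneg T' acyclic_unary_cqs)"
proof (intro notI, elim exE conjE)
  fix Epos Eneg :: "('a struct \<times> 'a) set"
  assume "finite Eneg"
    and ex: "\<forall>e \<in> Epos \<union> Eneg. is_pointed_structure e \<and> acyclic_struct (fst e)"
    and uc: "uniquely_characterizes Epos Eneg T' acyclic_unary_cqs"
  \<comment> \<open>The sum bounds the size of each negative example, so \<open>n\<close> exceeds
    all of them.\<close>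
  define n where "n = Suc (\<Sum>e \<in> Eneg. card (univ (fst e)))"
  have small: "card (univ (fst e)) < n" if "e \<in> Eneg" for e
    using member_le_sum[of e Eneg "\<lambda>e. card (univ (fst e))"] that \<open>finite Eneg\<close>
    by (simp add: n_def)
  have T': "fits T' Epos Eneg" using uc by (simp add: uniquely_characterizes_def)
  have "fits (zigzag_cq n) Epos Eneg"
    unfolding fits_def
  proof (intro conjI ballI)
    fix e assume "e \<in> Epos"
    then show "positive_example (zigzag_cq n) e"
      using T' answers_T'_subset_zigzag[of "fst e" n] by (auto simp: fits_def positive_example_def)
  next
    fix e assume e: "e \<in> Eneg"
    then have "snd e \<notin> answers T' (fst e)"
      using T' by (auto simp: fits_def negative_example_def positive_example_def)
    moreover have "is_structure (fst e)" "acyclic_struct (fst e)"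
      using ex e by (auto simp: is_pointed_structure_def)
    ultimately show "negative_example (zigzag_cq n) e"
      using zigzag_answers_large[of "fst e" "snd e" n] small[OF e]
      by (auto simp: negative_example_def positive_example_def)
  qed
  then show False
    using uc acyclic_zigzag zigzag_not_equivalent by (auto simp: uniquely_characterizes_def)
qed

end
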